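(* For every $(p_1,p_2)\in C\subset(0,1)^2$, with $C$ as defined in the context, the Laplace transform of the generalised Poisson-binomial random variable $X\sim\mathrm{PoiBin}_2(p_1,p_2)$ satisfies $$\mathbf{E}\,e^{tX}\leq\exp\left[\frac{1-p_1-p_2}{\log\left[\frac{1-p_1}{p_1}\cdot\frac{1-p_2}{p_2}\right]}\,t^2\right],\quad t\in\mathbb{R},$$ where for $p_1+p_2=1$ the coefficient of $t^2$ is understood as its limiting value $p_1(1-p_1)$.
   Context: For $p\in[0,1]$, a generalised Bernoulli random variable $X\sim\mathrm{Ber}(p)$ satisfies $\mathbf{P}(X=1-p)=p$ and $\mathbf{P}(X=-p)=1-p$. The distribution $\mathrm{PoiBin}_2(p_1,p_2)$ is the law of $X_1+X_2$ with $X_1\sim\mathrm{Ber}(p_1)$, $X_2\sim\mathrm{Ber}(p_2)$ independent generalised Bernoulli random variables. For $(p_1,p_2)\in(0,1)^2$ define $$g_{p_1,p_2}(t)=\frac{1}{t^2}\log\left[e^{-t(p_1+p_2)}\left(1+p_1(e^t-1)\right)\left(1+p_2(e^t-1)\right)\right],\quad t\ne 0,$$ extended to $t=0$ by continuity (the extended function is smooth on $\mathbb{R}$), and $t^*_{p_1,p_2}=\log\left[\frac{1-p_1}{p_1}\cdot\frac{1-p_2}{p_2}\right]$. A differentiable function $f:\mathbb{R}\to\mathbb{R}$ is called strictly unimodal if there exists $x\in\mathbb{R}$ such that $f'>0$ on $(-\infty,x)$ and $f'<0$ on $(x,\infty)$. The set $C\subset(0,1)^2$ consists of all $(p_1,p_2)\in(0,1)^2$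 such that: if $p_1+p_2<1$, then $g_{p_1,p_2}'(t)>0$ for all $0<t<t^*_{p_1,p_2}$; if $p_1+p_2>1$, then $g_{p_1,p_2}'(t)<0$ for all $t^*_{p_1,p_2}<t<0$; if $p_1+p_2=1$, then $g_{p_1,p_2}$ is strictly unimodal. *)

theory Defs
  imports "HOL-Probability.Probability"
begin

definition gen_bernoulli_pmf :: "real \<Rightarrow> real pmf" where
  "gen_bernoulli_pmf p = map_pmf (\<lambda>b. if b then 1 - p else - p) (bernoulli_pmf p)"

(* A pmf lives on the discrete sigma-algebra; the final distr restricts the law to the
   Borel sets, so that it can be compared with the law distr M borel X of a real random
   variable X. *)
definition PoiBin2 :: "real \<Rightarrow> real \<Rightarrow> real measure" where
  "PoiBin2 p1 p2 =
     distr (measure_pmf (map_pmf (\<lambda>(x1, x2). x1 + x2)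
              (pair_pmf (gen_bernoulli_pmf p1) (gen_bernoulli_pmf p2))))
       borel (\<lambda>x. x)"

definition g_punctured :: "real \<Rightarrow> real \<Rightarrow> real \<Rightarrow> real" where
  "g_punctured p1 p2 t =
     1 / t\<^sup>2 * ln (exp (- t * (p1 + p2)) * (1 + p1 * (exp t - 1)) * (1 + p2 * (exp t - 1)))"

definition g :: "real \<Rightarrow> real \<Rightarrow> real \<Rightarrow> real" where
  "g p1 p2 t = (if t = 0 then Lim (at 0) (g_punctured p1 p2) else g_punctured p1 p2 t)"

definition tstar :: "real \<Rightarrow> real \<Rightarrow> real" where
  "tstar p1 p2 = ln ((1 - p1) / p1 * ((1 - p2) / p2))"

definition strictly_unimodal :: "(real \<Rightarrow> real) \<Rightarrow> bool" where
  "strictly_unimodal f \<longleftrightarrow>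
     (\<forall>y. f differentiable at y) \<and>
     (\<exists>x. (\<forall>y<x. deriv f y > 0) \<and> (\<forall>y>x. deriv f y < 0))"

definition C :: "(real \<times> real) set" where
  "C = {(p1, p2). p1 \<in> {0<..<1} \<and> p2 \<in> {0<..<1} \<and>
     (p1 + p2 < 1 \<longrightarrow> (\<forall>t. 0 < t \<and> t < tstar p1 p2 \<longrightarrow> deriv (g p1 p2) t > 0)) \<and>
     (p1 + p2 > 1 \<longrightarrow> (\<forall>t. tstar p1 p2 < t \<and> t < 0 \<longrightarrow> deriv (g p1 p2) t < 0)) \<and>
     (p1 + p2 = 1 \<longrightarrow> strictly_unimodal (g p1 p2))}"

(* On p1 + p2 = 1 the quotient is 0/0; its limit there is p1 * p2 = p1 * (1 - p1). *)
definition subgaussian_coeff :: "real \<Rightarrow> real \<Rightarrow> real" where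
  "subgaussian_coeff p1 p2 =
     (if p1 + p2 = 1 then p1 * (1 - p1)
      else (1 - p1 - p2) / ln ((1 - p1) / p1 * ((1 - p2) / p2)))"

end

theory Submission
  imports Defs
begin

text \<open>
  Let \<open>L\<close> be the cumulant generating function, \<open>\<tau> = tstar p1 p2\<close> and \<open>c = (1 - p1 - p2) / \<tau>\<close>,
  with \<open>p1 + p2 < 1\<close>. The function \<open>D t = L t - c t\<^sup>2\<close> satisfies \<open>D (\<tau> - t) = D t\<close> and
  \<open>D 0 = D' 0 = 0\<close>. Monotonicity of \<open>g\<close> gives \<open>D < 0\<close> on \<open>(0, \<tau>)\<close>, so by symmetry only
  \<open>t < 0\<close> is left. Now \<open>L''\<close> is a unimodal rational function of
  \<open>w = (1 - p1) (1 - p2) e\<^sup>-\<^sup>t + p1 p2 e\<^sup>t\<close>, which is at most \<open>w 0\<close> on \<open>[0, \<tau>]\<close> and exceeds it for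
  \<open>t < 0\<close>. Together with \<open>D < 0\<close> on \<open>(0, \<tau>)\<close> this forces \<open>D'' \<le> 0\<close> on the negative axis, and hence
  \<open>D \<le> 0\<close> there. The case \<open>p1 + p2 > 1\<close> follows by reflecting \<open>p\<close> to \<open>1 - p\<close> and \<open>t\<close> to \<open>-t\<close>. If
  \<open>p1 + p2 = 1\<close>, then \<open>g\<close> is even, so its mode is \<open>0\<close>.
\<close>

section \<open>Cumulant generating function and its derivatives\<close>

locale bernoulli_pair =
  fixes p1 p2 :: real
  assumes p1: "0 < p1" "p1 < 1" and p2: "0 < p2" "p2 < 1"
begin

text \<open>The logarithm is split into summands so that it can be differentiated term by term;
  \<open>mgf_eq_exp_cgf\<close> identifies it with the logarithm inside
  \<open>g_punctured\<close>.\<close>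

definition cgf :: "real \<Rightarrow> real" where
  "cgf t = ln (1 + p1 * (exp t - 1)) + ln (1 + p2 * (exp t - 1)) - t * (p1 + p2)"

definition cgf' :: "real \<Rightarrow> real" where
  "cgf' t = p1 * exp t / (1 + p1 * (exp t - 1)) + p2 * exp t / (1 + p2 * (exp t - 1)) - (p1 + p2)"

definition cgf'' :: "real \<Rightarrow> real" where
  "cgf'' t = p1 * (1 - p1) * exp t / (1 + p1 * (exp t - 1))\<^sup>2
    + p2 * (1 - p2) * exp t / (1 + p2 * (exp t - 1))\<^sup>2"

lemma mgf_factor_pos: "0 < 1 + p1 * (exp t - 1)" "0 < 1 + p2 * (exp t - 1)"
proof -
  have "0 < (1 - p) + p * exp t" if "0 < p" "p < 1" for p :: real
    using that by (intro add_pos_pos) auto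
  from this[OF p1] this[OF p2]
  show "0 < 1 + p1 * (exp t - 1)" "0 < 1 + p2 * (exp t - 1)"
    by (simp_all add: algebra_simps)
qed

lemma mgf_eq_exp_cgf:
  "exp (- t * (p1 + p2)) * (1 + p1 * (exp t - 1)) * (1 + p2 * (exp t - 1)) = exp (cgf t)"
  using mgf_factor_pos[of t] by (simp add: cgf_def exp_diff exp_add exp_minus field_simps)

lemma g_punctured_eq: "g_punctured p1 p2 t = cgf t / t\<^sup>2"
  unfolding g_punctured_def mgf_eq_exp_cgf by simp

lemma cgf_0 [simp]: "cgf 0 = 0"
  by (simp add: cgf_def)

lemma cgf'_0 [simp]: "cgf' 0 = 0"
  by (simp add: cgf'_def)

lemma DERIV_cgf: "(cgf has_real_derivative cgf' t) (at t)"
  unfolding cgf_def cgf'_def using mgf_factor_pos[of t]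
  by (auto intro!: derivative_eq_intros simp: mult.commute)

lemma DERIV_cgf': "(cgf' has_real_derivative cgf'' t) (at t)"
proof -
  have "((\<lambda>t. p * exp t / (1 + p * (exp t - 1))) has_real_derivative
      p * (1 - p) * exp t / (1 + p * (exp t - 1))\<^sup>2) (at t)"
    if "0 < 1 + p * (exp t - 1)" for p
    using that
    by (auto intro!: derivative_eq_intros simp: power2_eq_square field_simps)
  from this[OF mgf_factor_pos(1)] this[OF mgf_factor_pos(2)] show ?thesis
    unfolding cgf'_def cgf''_def by (auto intro!: DERIV_add DERIV_diff[THEN DERIV_cong] DERIV_const)
qed

text \<open>The point of this form is that \<open>w\<close> takes the same value at \<open>t\<close> and
  \<open>tstar p1 p2 - t\<close>.\<close>
lemma cgf''_eq:
  fixes t :: real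
  defines "w \<equiv> (1 - p1) * (1 - p2) / exp t + p1 * p2 * exp t"
    and "e \<equiv> p1 * (1 - p2) + p2 * (1 - p1)"
  shows "cgf'' t = (e * w + 4 * (p1 * p2 * (1 - p1) * (1 - p2))) / (w + e)\<^sup>2"
proof -
  define x where "x = exp t"
  define A B where "A = 1 + p1 * (x - 1)" and "B = 1 + p2 * (x - 1)"
  have pos: "A > 0" "B > 0" "x > 0"
    using mgf_factor_pos[of t] by (simp_all add: A_def B_def x_def)
  have we: "w + e = A * B / x"
    using pos(3) by (simp add: w_def e_def A_def B_def x_def[symmetric] field_simps)
  have num: "(e * w + 4 * (p1 * p2 * (1 - p1) * (1 - p2))) * x
      = p1 * (1 - p1) * B\<^sup>2 + p2 * (1 - p2) * A\<^sup>2"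
    using pos(3)
    by (simp add: w_def e_def A_def B_def x_def[symmetric] field_simps power2_eq_square)
  have "cgf'' t = p1 * (1 - p1) * x / A\<^sup>2 + p2 * (1 - p2) * x / B\<^sup>2"
    by (simp add: cgf''_def A_def B_def x_def)
  also have "\<dots> = x * (p1 * (1 - p1) * B\<^sup>2 + p2 * (1 - p2) * A\<^sup>2) / (A * B)\<^sup>2"
    using pos by (simp add: field_simps power_mult_distrib)
  also have "\<dots> = (e * w + 4 * (p1 * p2 * (1 - p1) * (1 - p2))) / (w + e)\<^sup>2"
    unfolding we num[symmetric] using pos by (simp add: field_simps power2_eq_square)
  finally show ?thesis .
qed

section \<open>Reflection about \<open>tstar p1 p2 / 2\<close>\<close>

lemma exp_tstar: "exp (tstar p1 p2) = (1 - p1) * (1 - p2) / (p1 * p2)"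
  using p1 p2 by (simp add: tstar_def)

lemma tstar_pos: "p1 + p2 < 1 \<Longrightarrow> 0 < tstar p1 p2"
  unfolding tstar_def using p1 p2 by (intro ln_gt_zero) (simp add: field_simps)

text \<open>The reflection turns each of the two factors of the Laplace transform into a multiple of
  the other one. The logarithms of the multipliers add up to
  \<open>tstar p1 p2 - 2 * t\<close>.\<close>

lemma cgf_reflect: "cgf (tstar p1 p2 - t) = cgf t + (tstar p1 p2 - 2 * t) * (1 - p1 - p2)"
proof -
  define x where "x = exp t"
  have x: "x > 0" by (simp add: x_def)
  have E: "exp (tstar p1 p2 - t) = (1 - p1) * (1 - p2) / (p1 * p2 * x)"
    by (simp add: exp_diff exp_tstar x_def)
  have 1: "1 + p1 * (exp (tstar p1 p2 - t) - 1) = (1 - p1) / p2 / x * (1 + p2 * (x - 1))"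
    unfolding E using p1 p2 x by (simp add: field_simps)
  have 2: "1 + p2 * (exp (tstar p1 p2 - t) - 1) = (1 - p2) / p1 / x * (1 + p1 * (x - 1))"
    unfolding E using p1 p2 x by (simp add: field_simps)
  have pos: "1 + p1 * (x - 1) > 0" "1 + p2 * (x - 1) > 0"
    using mgf_factor_pos[of t] by (simp_all add: x_def)
  have lnx: "ln x = t" by (simp add: x_def)
  have T: "tstar p1 p2 = ln (1 - p1) + ln (1 - p2) - ln p1 - ln p2"
    using p1 p2 by (simp add: tstar_def ln_mult ln_div)
  have "ln (1 + p1 * (exp (tstar p1 p2 - t) - 1)) = ln (1 - p1) - ln p2 - t + ln (1 + p2 * (x - 1))"
    unfolding 1 using pos p1 p2 x lnx by (simp add: ln_mult ln_div)
  moreover have "ln (1 + p2 * (exp (tstar p1 p2 - t) - 1))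
      = ln (1 - p2) - ln p1 - t + ln (1 + p1 * (x - 1))"
    unfolding 2 using pos p1 p2 x lnx by (simp add: ln_mult ln_div)
  ultimately have "ln (1 + p1 * (exp (tstar p1 p2 - t) - 1)) + ln (1 + p2 * (exp (tstar p1 p2 - t) - 1))
      = tstar p1 p2 - 2 * t + ln (1 + p1 * (x - 1)) + ln (1 + p2 * (x - 1))"
    using T by linarith
  thus ?thesis
    unfolding cgf_def x_def[symmetric] by (simp add: algebra_simps)
qed

section \<open>Derivative of \<open>g\<close> and the case \<open>p1 + p2 < 1\<close>\<close>

lemma g_eq: "t \<noteq> 0 \<Longrightarrow> g p1 p2 t = cgf t / t\<^sup>2"
  by (simp add: g_def g_punctured_eq)

text \<open>On the open set \<open>- {0}\<close> the quotient formula applies, so the limit value at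
  \<open>0\<close> does not enter. Keeping \<open>deriv\<close> in the conclusion lets sign
  conditions on \<open>deriv\<close> be applied directly.\<close>

lemma DERIV_g:
  assumes "t \<noteq> 0"
  shows "(g p1 p2 has_real_derivative deriv (g p1 p2) t) (at t)"
proof -
  have "((\<lambda>t. cgf t / t\<^sup>2) has_real_derivative (cgf' t * t\<^sup>2 - cgf t * (2 * t)) / (t\<^sup>2 * t\<^sup>2)) (at t)"
    using assms by (auto intro!: derivative_eq_intros DERIV_cgf)
  hence "(g p1 p2 has_real_derivative (cgf' t * t\<^sup>2 - cgf t * (2 * t)) / (t\<^sup>2 * t\<^sup>2)) (at t)"
    by (rule has_field_derivative_transform_within_open[where S = "- {0}"])
      (use assms in \<open>auto simp: g_eq\<close>)
  thus ?thesis
    by (metis DERIV_imp_deriv)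
qed

lemma cgf_le_of_deriv_pos:
  assumes lt: "p1 + p2 < 1"
    and incr: "\<And>t. 0 < t \<Longrightarrow> t < tstar p1 p2 \<Longrightarrow> 0 < deriv (g p1 p2) t"
  shows "cgf t \<le> (1 - p1 - p2) / tstar p1 p2 * t\<^sup>2"
proof -
  define \<tau> where "\<tau> = tstar p1 p2"
  \<comment> \<open>With this constant \<open>c * \<tau>\<close> is the slope of the linear term in
    \<open>cgf_reflect\<close>, so subtracting \<open>c\<close> times the square makes the
    reflection an exact symmetry.\<close>
  define c where "c = (1 - p1 - p2) / \<tau>"
  define D D' D'' where "D = (\<lambda>t. cgf t - c * t\<^sup>2)"
    and "D' = (\<lambda>t. cgf' t - 2 * c * t)" and "D'' = (\<lambda>t. cgf'' t - 2 * c)"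
  have \<tau>: "0 < \<tau>"
    using tstar_pos[OF lt] by (simp add: \<tau>_def)
  have c\<tau>: "1 - p1 - p2 = c * \<tau>"
    using \<tau> by (simp add: c_def)
  have D_deriv: "(D has_real_derivative D' t) (at t)" for t
    unfolding D_def D'_def by (auto intro!: derivative_eq_intros DERIV_cgf)
  have D'_deriv: "(D' has_real_derivative D'' t) (at t)" for t
    unfolding D'_def D''_def by (auto intro!: derivative_eq_intros DERIV_cgf')
  have sym: "D (\<tau> - t) = D t" for t
    unfolding D_def using cgf_reflect[of t, folded \<tau>_def, unfolded c\<tau>]
    by (simp add: algebra_simps power2_eq_square)
  have D0: "D 0 = 0" "D' 0 = 0"
    by (simp_all add: D_def D'_def)
  have D\<tau>: "D \<tau> = 0"
    using sym[of 0] D0 by simp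
  have neg: "D t < 0" if "0 < t" "t < \<tau>" for t
  proof -
    \<comment> \<open>The value of \<open>g\<close> at \<open>\<tau>\<close> is \<open>c\<close>, so
      this says that \<open>D\<close> is negative at \<open>t\<close>.\<close>
    have "g p1 p2 t < g p1 p2 \<tau>"
    proof (rule DERIV_pos_imp_increasing_open[OF that(2)])
      show "\<exists>y. (g p1 p2 has_real_derivative y) (at x) \<and> 0 < y" if "t < x" "x < \<tau>" for x
        using DERIV_g[of x] incr[of x] that \<open>0 < t\<close> by (auto simp: \<tau>_def)
      show "continuous_on {t..\<tau>} (g p1 p2)"
        using that by (intro continuous_at_imp_continuous_on ballI DERIV_isCont[OF DERIV_g]) auto
    qed
    moreover have "cgf \<tau> = c * \<tau>\<^sup>2"
      using D\<tau> by (simp add: D_def)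
    ultimately show ?thesis
      using that by (simp add: g_eq D_def field_simps)
  qed
  define w where "w = (\<lambda>t. (1 - p1) * (1 - p2) / exp t + p1 * p2 * exp t)"
  define e r where "e = p1 * (1 - p2) + p2 * (1 - p1)" and "r = p1 * p2 * (1 - p1) * (1 - p2)"
  \<comment> \<open>The numerator of \<open>D''\<close> over the positive denominator
    \<open>(w t + e)\<^sup>2\<close>, hence its sign.\<close>
  define Q where "Q = (\<lambda>w. e * w + 4 * r - 2 * c * (w + e)\<^sup>2)"
  have e: "0 < e"
    using p1 p2 by (auto simp: e_def intro!: add_pos_pos mult_pos_pos)
  have w_pos: "0 < w t" for t
    using p1 p2 by (auto simp: w_def intro!: add_pos_pos mult_pos_pos divide_pos_pos)
  have cgf''_w: "cgf'' t = (e * w t + 4 * r) / (w t + e)\<^sup>2" for t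
    unfolding w_def e_def r_def by (rule cgf''_eq)
  have "D'' t = Q (w t) / (w t + e)\<^sup>2" for t
    using w_pos[of t] e by (simp add: D''_def Q_def cgf''_w diff_divide_distrib)
  hence D''_sgn: "D'' t \<le> 0 \<longleftrightarrow> Q (w t) \<le> 0" "D'' t > 0 \<longleftrightarrow> Q (w t) > 0" for t
    using w_pos[of t] e by (auto simp: divide_le_0_iff zero_less_divide_iff not_le)
  have c: "0 < c"
    using lt \<tau> by (simp add: c_def)
  \<comment> \<open>As \<open>w 0 = w \<tau>\<close>, the numerator is a quadratic in
    \<open>exp t\<close> with roots \<open>1\<close> and \<open>exp \<tau>\<close>.\<close>
  have w_diff: "w t - w 0 = p1 * p2 * (exp t - 1) * (exp t - exp \<tau>) / exp t" for t
    using p1 p2 by (simp add: w_def \<tau>_def exp_tstar field_simps)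
  have w_le: "w t \<le> w 0" if "0 \<le> t" "t \<le> \<tau>" for t
  proof -
    have "p1 * p2 * (exp t - 1) * (exp t - exp \<tau>) \<le> 0"
      using that p1 p2 by (intro mult_nonneg_nonpos) auto
    hence "w t - w 0 \<le> 0"
      unfolding w_diff by (simp add: divide_nonpos_pos)
    thus ?thesis by simp
  qed
  have w_ge: "w 0 < w t" if "t < 0" for t
  proof -
    have "0 < p1 * p2 * (exp t - 1) * (exp t - exp \<tau>)"
      using that p1 p2 \<tau> by (intro mult_neg_neg[OF mult_pos_neg]) auto
    hence "0 < w t - w 0"
      unfolding w_diff by simp
    thus ?thesis by simp
  qed
  \<comment> \<open>Otherwise \<open>D'\<close>, and then \<open>D\<close>, would be positive just
    to the right of \<open>0\<close>, against \<open>neg\<close>.\<close>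
  have D''0: "D'' 0 \<le> 0"
  proof (rule ccontr)
    assume "\<not> D'' 0 \<le> 0"
    then obtain d where d: "d > 0" "\<And>h. 0 < h \<Longrightarrow> h < d \<Longrightarrow> D' 0 < D' (0 + h)"
      using DERIV_pos_inc_right[OF D'_deriv[of 0]] by auto
    define s where "s = min d \<tau> / 2"
    have s: "0 < s" "s < d" "s < \<tau>"
      using d(1) \<tau> by (auto simp: s_def)
    have "D 0 < D s"
    proof (rule DERIV_pos_imp_increasing_open[OF s(1)])
      show "\<exists>y. (D has_real_derivative y) (at x) \<and> 0 < y" if "0 < x" "x < s" for x
        using D_deriv[of x] d(2)[of x] that s D0 by auto
      show "continuous_on {0..s} D"
        by (intro continuous_at_imp_continuous_on ballI DERIV_isCont[OF D_deriv])
    qed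
    with neg[OF s(1,3)] D0 show False by simp
  qed
  text \<open>If the concave quadratic \<open>Q\<close> were positive somewhere to the right of \<open>w 0\<close>, it would be
    nonpositive to the left of it, so \<open>D\<close> would be concave on \<open>[0, \<tau>]\<close> with \<open>D' 0 = 0\<close>; then
    \<open>D \<tau> = 0\<close> would force \<open>D \<ge> 0\<close> there.\<close>
  have Q: "Q v \<le> 0" if v: "w 0 < v" for v
  proof (rule ccontr)
    assume "\<not> Q v \<le> 0"
    hence Qv: "Q v > 0" by simp
    have Q0: "Q (w 0) \<le> 0"
      using D''0 D''_sgn by simp
    have Qle: "Q u \<le> 0" if u: "u \<le> w 0" for u
    proof (rule ccontr)
      assume Qu: "\<not> Q u \<le> 0"
      hence u': "u < w 0"
        using u Q0 by (cases "u = w 0") auto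
      \<comment> \<open>Concavity made explicit: \<open>w 0\<close> is a convex combination of
        \<open>u\<close> and \<open>v\<close>, and the last term is the gap caused by the leading
        coefficient \<open>- 2 * c\<close> of \<open>Q\<close>.\<close>
      have "(v - u) * Q (w 0) = (v - w 0) * Q u + (w 0 - u) * Q v
          + 2 * c * ((v - u) * (v - w 0) * (w 0 - u))"
        by (simp add: Q_def algebra_simps power2_eq_square)
      also have "\<dots> > 0"
        using u' v Qu Qv c by (intro add_pos_pos mult_pos_pos) auto
      finally show False
        using Q0 u' v by (simp add: zero_less_mult_iff)
    qed
    have D''_le: "D'' x \<le> 0" if "0 \<le> x" "x \<le> \<tau>" for x
      using Qle[OF w_le[OF that]] D''_sgn by simp
    have D'_le: "D' x \<le> 0" if "0 \<le> x" "x \<le> \<tau>" for x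
    proof -
      have "D' x \<le> D' 0"
      proof (rule DERIV_nonpos_imp_nonincreasing[of 0 x D'])
        show "\<exists>z. (D' has_real_derivative z) (at y) \<and> z \<le> 0" if "0 \<le> y" "y \<le> x" for y
          using D'_deriv[of y] D''_le[of y] that \<open>x \<le> \<tau>\<close> by auto
      qed (use \<open>0 \<le> x\<close> in simp)
      thus ?thesis using D0 by simp
    qed
    have "D \<tau> \<le> D (\<tau> / 2)"
    proof (rule DERIV_nonpos_imp_nonincreasing[of "\<tau> / 2" \<tau> D])
      show "\<exists>y. (D has_real_derivative y) (at x) \<and> y \<le> 0" if "\<tau> / 2 \<le> x" "x \<le> \<tau>" for x
        using D_deriv[of x] D'_le[of x] that \<tau> by auto
    qed (use \<tau> in simp)
    with neg[of "\<tau> / 2"] \<tau> D\<tau> show False by simp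
  qed
  have D_neg: "D t \<le> 0" if "t < 0" for t
  proof -
    have D'_ge: "0 \<le> D' x" if "x \<le> 0" for x
    proof -
      have "D' 0 \<le> D' x"
      proof (rule DERIV_nonpos_imp_nonincreasing[of x 0 D'])
        show "\<exists>z. (D' has_real_derivative z) (at y) \<and> z \<le> 0" if "x \<le> y" "y \<le> 0" for y
          using D'_deriv[of y] D''0 Q[OF w_ge[of y]] D''_sgn(1)[of y] that
          by (cases "y = 0") auto
      qed (use \<open>x \<le> 0\<close> in simp)
      thus ?thesis using D0 by simp
    qed
    have "D t \<le> D 0"
    proof (rule DERIV_nonneg_imp_nondecreasing[of t 0 D])
      show "\<exists>y. (D has_real_derivative y) (at x) \<and> 0 \<le> y" if "t \<le> x" "x \<le> 0" for x
        using D_deriv[of x] D'_ge[of x] that by auto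
    qed (use \<open>t < 0\<close> in simp)
    thus ?thesis using D0 by simp
  qed
  have "D t \<le> 0"
  proof -
    \<comment> \<open>Beyond \<open>\<tau>\<close>, the symmetry leads back to the negative argument
      \<open>\<tau> - t\<close>.\<close>
    consider "t < 0" | "t = 0" | "0 < t" "t < \<tau>" | "t = \<tau>" | "\<tau> < t" by linarith
    thus ?thesis
      using D_neg[of t] D0 D\<tau> neg[of t] D_neg[of "\<tau> - t"] sym[of t] by cases auto
  qed
  thus ?thesis
    by (simp add: D_def c_def \<tau>_def)
qed

section \<open>The case \<open>p1 + p2 = 1\<close>\<close>

lemma cgf_even:
  assumes "p1 + p2 = 1"
  shows "cgf (- t) = cgf t"
proof -
  \<comment> \<open>The two odds ratios are reciprocal, so the reflection is about
    \<open>0\<close>.\<close>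
  have "tstar p1 p2 = 0"
    using p1 p2 assms by (simp add: tstar_def eq_diff_eq[symmetric])
  thus ?thesis
    using cgf_reflect[of t] assms by simp
qed

text \<open>One application of l'Hopital suffices: the quotient of derivatives is half the
  difference quotient of \<open>cgf'\<close> at \<open>0\<close>. The value is invariant under
  replacing each parameter by its complement.\<close>

lemma g_0: "g p1 p2 0 = (p1 * (1 - p1) + p2 * (1 - p2)) / 2"
proof -
  have "((\<lambda>t. (cgf' t - cgf' 0) / (t - 0)) \<longlongrightarrow> cgf'' 0) (at 0)"
    using DERIV_cgf'[of 0] by (simp add: has_field_derivative_iff)
  hence "((\<lambda>t. cgf' t / t / 2) \<longlongrightarrow> cgf'' 0 / 2) (at 0)"
    by (intro tendsto_divide) auto
  hence lim: "((\<lambda>t. cgf' t / (2 * t)) \<longlongrightarrow> cgf'' 0 / 2) (at 0)"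
    by (simp add: field_simps)
  have nz: "\<forall>\<^sub>F t :: real in at 0. t \<noteq> 0"
    by (simp add: eventually_at_filter)
  have cont0: "(cgf \<longlongrightarrow> 0) (at 0)"
    using DERIV_isCont[OF DERIV_cgf[of 0]] by (simp add: isCont_def)
  have "((\<lambda>t. cgf t / t\<^sup>2) \<longlongrightarrow> cgf'' 0 / 2) (at 0)"
  proof (rule lhopital[OF cont0 _ _ _ _ _ lim])
    show "((\<lambda>t :: real. t\<^sup>2) \<longlongrightarrow> 0) (at 0)"
      by (auto intro!: tendsto_eq_intros)
    show "\<forall>\<^sub>F t in at 0. (cgf has_real_derivative cgf' t) (at t)"
      by (simp add: DERIV_cgf)
    show "\<forall>\<^sub>F t in at 0. ((\<lambda>t :: real. t\<^sup>2) has_real_derivative 2 * t) (at t)"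
      by (auto intro!: always_eventually derivative_eq_intros)
  qed (use nz in \<open>auto elim: eventually_mono\<close>)
  hence "Lim (at 0) (g_punctured p1 p2) = cgf'' 0 / 2"
    unfolding g_punctured_eq[abs_def] by (intro tendsto_Lim) auto
  thus ?thesis
    by (simp add: g_def cgf''_def)
qed

lemma cgf_le_of_strictly_unimodal:
  assumes sum1: "p1 + p2 = 1" and uni: "strictly_unimodal (g p1 p2)"
  shows "cgf t \<le> p1 * (1 - p1) * t\<^sup>2"
proof -
  from uni obtain m where diff: "\<And>y. g p1 p2 differentiable at y"
    and incr: "\<And>y. y < m \<Longrightarrow> 0 < deriv (g p1 p2) y"
    and decr: "\<And>y. m < y \<Longrightarrow> deriv (g p1 p2) y < 0"
    unfolding strictly_unimodal_def by blast
  have deriv: "(g p1 p2 has_real_derivative deriv (g p1 p2) y) (at y)" for y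
    using diff[of y] by (metis DERIV_deriv_iff_real_differentiable)
  have even: "g p1 p2 (- y) = g p1 p2 y" for y
    by (cases "y = 0") (auto simp: g_eq cgf_even[OF sum1])
  have cont: "continuous_on S (g p1 p2)" for S
    by (intro continuous_at_imp_continuous_on ballI DERIV_isCont[OF deriv])
  have less_l: "g p1 p2 x < g p1 p2 y" if "x < y" "y \<le> m" for x y
  proof (rule DERIV_pos_imp_increasing_open[OF that(1) _ cont])
    show "\<exists>d. (g p1 p2 has_real_derivative d) (at z) \<and> 0 < d" if "x < z" "z < y" for z
      using deriv[of z] incr[of z] that \<open>y \<le> m\<close> by auto
  qed
  have less_r: "g p1 p2 y < g p1 p2 x" if "x < y" "m \<le> x" for x y
  proof (rule DERIV_neg_imp_decreasing_open[OF that(1) _ cont])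
    show "\<exists>d. (g p1 p2 has_real_derivative d) (at z) \<and> d < 0" if "x < z" "z < y" for z
      using deriv[of z] decr[of z] that \<open>m \<le> x\<close> by auto
  qed
  \<comment> \<open>If \<open>m\<close> were nonzero, \<open>m\<close> and \<open>- m\<close> would
    lie on a common side of the mode, endpoint included, and strict monotonicity would contradict
    evenness.\<close>
  have m: "m = 0"
    using less_l[of "- m" m] less_r[of m "- m"] even[of m] by linarith
  have "g p1 p2 0 = p1 * (1 - p1)"
  proof -
    have "p2 = 1 - p1" using sum1 by simp
    have "(p1 * (1 - p1) + p2 * (1 - p2)) / 2 = p1 * (1 - p1)"
      unfolding \<open>p2 = 1 - p1\<close> by (simp add: field_simps)
    thus ?thesis by (simp only: g_0)
  qed
  hence "g p1 p2 t \<le> p1 * (1 - p1)"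
    using less_l[of t 0] less_r[of 0 t] m by (cases t "0 :: real" rule: linorder_cases) auto
  thus ?thesis
    by (cases "t = 0") (auto simp: g_eq field_simps)
qed

section \<open>Laplace transform of \<open>PoiBin2\<close>\<close>

lemma expectation_exp_PoiBin2:
  assumes "prob_space M" and X: "X \<in> borel_measurable M"
    and distr: "distr M borel X = PoiBin2 p1 p2"
  shows "prob_space.expectation M (\<lambda>\<omega>. exp (t * X \<omega>)) = exp (cgf t)"
proof -
  have pq: "p1 \<in> {0..1}" "p2 \<in> {0..1}"
    using p1 p2 by auto
  \<comment> \<open>Pulling the law back to pairs of Booleans makes the expectation a sum of four
    terms.\<close>
  define f where "f = (\<lambda>(a, b). (if a then 1 - p1 else - p1) + (if b then 1 - p2 else - p2))"
  have law: "map_pmf (\<lambda>(x1, x2). x1 + x2)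
      (pair_pmf (gen_bernoulli_pmf p1) (gen_bernoulli_pmf p2))
      = map_pmf f (pair_pmf (bernoulli_pmf p1) (bernoulli_pmf p2))"
    unfolding gen_bernoulli_pmf_def map_pair[symmetric] pmf.map_comp f_def
    by (intro map_pmf_cong) auto
  have "(\<integral>\<omega>. exp (t * X \<omega>) \<partial>M) = (\<integral>x. exp (t * x) \<partial>distr M borel X)"
    using X by (subst integral_distr) auto
  also have "\<dots> = (\<integral>b. exp (t * f b) \<partial>pair_pmf (bernoulli_pmf p1) (bernoulli_pmf p2))"
    unfolding distr PoiBin2_def law by (subst integral_distr) auto
  also have "\<dots> = (\<Sum>b\<in>UNIV. exp (t * f b) * pmf (pair_pmf (bernoulli_pmf p1) (bernoulli_pmf p2)) b)"
    by (intro integral_measure_pmf_real) auto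
  also have "\<dots> = exp (- t * (p1 + p2)) * (1 + p1 * (exp t - 1)) * (1 + p2 * (exp t - 1))"
    using pq mult_exp_exp[of t t, symmetric]
    by (simp add: f_def UNIV_Times_UNIV[symmetric] sum.cartesian_product[symmetric] UNIV_bool
        pmf_pair exp_add exp_diff exp_minus field_simps del: UNIV_Times_UNIV)
  finally show ?thesis
    by (simp only: mgf_eq_exp_cgf)
qed

end

theorem corollary1p4:
  fixes p1 p2 :: real and M :: "'a measure" and X :: "'a \<Rightarrow> real"
  assumes "(p1, p2) \<in> C"
    and "prob_space M"
    and "X \<in> borel_measurable M"
    and "distr M borel X = PoiBin2 p1 p2"
  shows "\<forall>t::real. prob_space.expectation M (\<lambda>\<omega>. exp (t * X \<omega>)) \<le> exp (subgaussian_coeff p1 p2 * t\<^sup>2)"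
proof
  fix t
  interpret bernoulli_pair p1 p2
    using assms(1) by unfold_locales (auto simp: C_def)
  \<comment> \<open>The complementary parameters describe the law of \<open>- X\<close>; they serve
    the case \<open>p1 + p2 > 1\<close>.\<close>
  interpret refl: bernoulli_pair "1 - p1" "1 - p2"
    using p1 p2 by unfold_locales auto
  have "cgf t \<le> subgaussian_coeff p1 p2 * t\<^sup>2"
  proof (cases "p1 + p2" "1 :: real" rule: linorder_cases)
    case less
    thus ?thesis
      using cgf_le_of_deriv_pos[OF less, of t] assms(1)
      by (simp add: C_def subgaussian_coeff_def tstar_def)
  next
    case equal
    thus ?thesis
      using cgf_le_of_strictly_unimodal[OF equal, of t] assms(1)
      by (simp add: C_def subgaussian_coeff_def)
  next
    case greater
    have cgf_refl: "refl.cgf s = cgf (- s)" for s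
    proof -
      have "exp (refl.cgf s) = exp (cgf (- s))"
        unfolding mgf_eq_exp_cgf[symmetric] refl.mgf_eq_exp_cgf[symmetric]
        using mult_exp_exp[of s s, symmetric]
        by (simp add: exp_add exp_diff exp_minus field_simps)
      thus ?thesis by simp
    qed
    have tstar_refl: "tstar (1 - p1) (1 - p2) = - tstar p1 p2"
      using p1 p2 by (simp add: tstar_def ln_mult ln_div)
    have "0 < deriv (g (1 - p1) (1 - p2)) s" if "0 < s" "s < tstar (1 - p1) (1 - p2)" for s
    proof -
      \<comment> \<open>Equality also at \<open>0\<close>, through \<open>g_0\<close>, gives an
        equation of functions that can be rewritten under \<open>deriv\<close>.\<close>
      have "g (1 - p1) (1 - p2) s = g p1 p2 (- s)" for s
        by (cases "s = 0") (simp_all add: g_0 refl.g_0 g_eq refl.g_eq cgf_refl algebra_simps)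
      hence "g (1 - p1) (1 - p2) = (\<lambda>s. g p1 p2 (- s))" by blast
      moreover have "((\<lambda>s. g p1 p2 (- s)) has_real_derivative deriv (g p1 p2) (- s) * (- 1)) (at s)"
        using that by (intro DERIV_chain2[OF DERIV_g]) (auto intro!: derivative_eq_intros)
      ultimately have "deriv (g (1 - p1) (1 - p2)) s = - deriv (g p1 p2) (- s)"
        by (simp add: DERIV_imp_deriv)
      moreover have "deriv (g p1 p2) (- s) < 0"
        using assms(1) greater that by (simp add: C_def tstar_refl)
      ultimately show ?thesis by simp
    qed
    hence "refl.cgf (- t) \<le> (1 - (1 - p1) - (1 - p2)) / tstar (1 - p1) (1 - p2) * (- t)\<^sup>2"
      using greater by (intro refl.cgf_le_of_deriv_pos) auto
    \<comment> \<open>Numerator and denominator both change sign.\<close>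
    also have "(1 - (1 - p1) - (1 - p2)) / tstar (1 - p1) (1 - p2) = subgaussian_coeff p1 p2"
      using greater by (simp add: tstar_refl subgaussian_coeff_def)
        (simp add: tstar_def minus_divide_divide[of "1 - p1 - p2", symmetric])
    finally show ?thesis
      by (simp add: cgf_refl)
  qed
  thus "prob_space.expectation M (\<lambda>\<omega>. exp (t * X \<omega>)) \<le> exp (subgaussian_coeff p1 p2 * t\<^sup>2)"
    using expectation_exp_PoiBin2[OF assms(2-4)] by simp
qed

end
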